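(* Let $(C_n)_{n\in\mathbb{N}}$ be a family of XOR-circuits, $C_n$ over the $n$-dimensional hypercube $\mathcal{H}_n$, such that for all $n$: (1) $|V_{C_n}|$ is polynomial in $2^n$ (there is a polynomial $p$ with $|V_{C_n}|\le p(2^n)$ for all $n$); (2) every permutation $\pi\in\mathrm{Sym}_n$ acting on $\{0,1\}^n$ extends to an automorphism of $C_n$; (3) there is a function $f(n)\in O(n)$ such that for all sufficiently large $n$, for every gate $g$ of $C_n$ and every parent $h$ of $g$, both $|\mathrm{Orbit}_{(g)}(h)|\le f(n)$ and $|\mathrm{Orbit}_{(h)}(g)|\le f(n)$. Then for every constant $\varepsilon>0$ and all sufficiently large $n$ the following holds: if $C_n$ is sensitive to an input gate $g$ with $\ell(g)=\{u,v\}$, then at least one of $u,v$ contains fewer than $\varepsilon n$ ones or fewer than $\varepsilon n$ zeros.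
   Context: $\mathcal{H}_n$ has vertex set $\{0,1\}^n$, with $u,v$ adjacent iff they differ in exactly one position. $\mathrm{Sym}_n$ acts on $\{0,1\}^n$ by $\pi(v_1\dots v_n)=v_{\pi^{-1}(1)}\dots v_{\pi^{-1}(n)}$ and hence on edges of $\mathcal{H}_n$. An XOR-circuit over $\mathcal{H}_n$ is a finite connected DAG $C=(V_C,E_C)$ with a unique designated root; a wire $(g,h)\in E_C$ means $h$ is a child of $g$ and $g$ a parent of $h$. Leaves are input gates, injectively labelled by $\ell$ with edges of $\mathcal{H}_n$; internal gates compute the XOR of their children; the output is the value of the root. $C$ is sensitive to an input gate $g$ if flipping the input bit of $g$ (with all other input bits fixed) changes the output. $\mathrm{Aut}(C_n)$ is the set of automorphisms $\sigma$ of the rooted DAG $(V_{C_n},E_{C_n})$ for which there is $\pi\in\mathrm{Sym}_n$ with $\ell(\sigma(g))=\pi(\ell(g))$ for every input gate $g$; we then say $\pi$ extends to $\sigma$. For gates $g,h$: $\mathrm{Orbit}_{(g)}(h):=\{\sigma(h)\mid \sigma\in\mathrm{Aut}(C_n),\ \sigma(g)=g\}$ and $\mathrm{Orbit}_{(h)}(g):=\{\sigma(g)\mid\sigma\in\mathrm{Aut}(C_n),\ \sigma(h)=h\}$. *)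

theory Defs
  imports
    Complex_Main
    "HOL-Library.Landau_Symbols"
    "HOL-Computational_Algebra.Polynomial"
    "HOL-Combinatorics.Permutations"
begin

text \<open>Words in \<open>{0,1}\<^sup>n\<close> are Boolean lists of length \<open>n\<close>, with positions \<open>0, \<dots>, n - 1\<close>.\<close>

definition cube_verts :: "nat \<Rightarrow> bool list set" where
  "cube_verts n = {v. length v = n}"

definition cube_edges :: "nat \<Rightarrow> bool list set set" where
  "cube_edges n = {{u, v} | u v. u \<in> cube_verts n \<and> v \<in> cube_verts n \<and>
      card {i. i < n \<and> u ! i \<noteq> v ! i} = 1}"

text \<open>Position \<open>i\<close> of \<open>act_vert \<pi> v\<close> is \<open>v ! inv \<pi> i\<close>.\<close>

definition act_vert :: "(nat \<Rightarrow> nat) \<Rightarrow> bool list \<Rightarrow> bool list" where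
  "act_vert \<pi> v = permute_list (inv \<pi>) v"

definition act_edge :: "(nat \<Rightarrow> nat) \<Rightarrow> bool list set \<Rightarrow> bool list set" where
  "act_edge \<pi> e = act_vert \<pi> ` e"

definition num_ones :: "bool list \<Rightarrow> nat" where
  "num_ones v = card {i. i < length v \<and> v ! i}"

definition num_zeros :: "bool list \<Rightarrow> nat" where
  "num_zeros v = card {i. i < length v \<and> \<not> v ! i}"

text \<open>A wire \<open>(g, h)\<close> leads from the parent \<open>g\<close> to its child \<open>h\<close>. The labelling \<open>elabel\<close> is
  relevant only on input gates.\<close>

record 'g circuit =
  gates :: "'g set"
  wires :: "('g \<times> 'g) set"
  root_gate :: 'g
  elabel :: "'g \<Rightarrow> bool list set"

definition children :: "'g circuit \<Rightarrow> 'g \<Rightarrow> 'g set" where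
  "children C g = {h. (g, h) \<in> wires C}"

definition parents :: "'g circuit \<Rightarrow> 'g \<Rightarrow> 'g set" where
  "parents C g = {h. (h, g) \<in> wires C}"

definition input_gates :: "'g circuit \<Rightarrow> 'g set" where
  "input_gates C = {g \<in> gates C. children C g = {}}"

definition xor_circuit :: "nat \<Rightarrow> 'g circuit \<Rightarrow> bool" where
  "xor_circuit n C \<longleftrightarrow>
     finite (gates C) \<and>
     wires C \<subseteq> gates C \<times> gates C \<and>
     acyclic (wires C) \<and>
     (\<forall>g\<in>gates C. \<forall>h\<in>gates C. (g, h) \<in> (wires C \<union> (wires C)\<inverse>)\<^sup>*) \<and>
     root_gate C \<in> gates C \<and>
     (\<forall>g\<in>gates C. parents C g = {} \<longleftrightarrow> g = root_gate C) \<and>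
     elabel C ` input_gates C \<subseteq> cube_edges n \<and>
     inj_on (elabel C) (input_gates C)"

text \<open>An input \<open>x\<close> assigns a bit to every edge of the hypercube. Gates are evaluated by
  recursion from a gate to its children, which is well-founded in a finite acyclic graph.\<close>

definition gate_val :: "'g circuit \<Rightarrow> (bool list set \<Rightarrow> bool) \<Rightarrow> 'g \<Rightarrow> bool" where
  "gate_val C x = wfrec ((wires C)\<inverse>)
     (\<lambda>val g. if children C g = {} then x (elabel C g)
              else odd (card {h \<in> children C g. val h}))"

lemma gate_val_unfold:
  assumes "xor_circuit n C"
  shows "gate_val C x g =
    (if children C g = {} then x (elabel C g)
     else odd (card {h \<in> children C g. gate_val C x h}))"
proof -
  have "finite (wires C)"
    using assms unfolding xor_circuit_def by (meson finite_SigmaI finite_subset)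
  then have "wf ((wires C)\<inverse>)"
    using assms unfolding xor_circuit_def by (simp add: finite_acyclic_wf_converse)
  note * = def_wfrec[OF gate_val_def[THEN eq_reflection] this, of x g]
  have "{h \<in> children C g. cut (gate_val C x) ((wires C)\<inverse>) g h}
      = {h \<in> children C g. gate_val C x h}"
    by (auto simp: children_def cut_def)
  with * show ?thesis by simp
qed

definition circuit_output :: "'g circuit \<Rightarrow> (bool list set \<Rightarrow> bool) \<Rightarrow> bool" where
  "circuit_output C x = gate_val C x (root_gate C)"

text \<open>Labels being injective, the bit of the edge \<open>elabel C g\<close> is the input bit of \<open>g\<close> alone.\<close>

definition sensitive_to :: "'g circuit \<Rightarrow> 'g \<Rightarrow> bool" where
  "sensitive_to C g \<longleftrightarrow>
     (\<exists>x. circuit_output C (x(elabel C g := \<not> x (elabel C g))) \<noteq> circuit_output C x)"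

definition rooted_dag_aut :: "'g circuit \<Rightarrow> ('g \<Rightarrow> 'g) \<Rightarrow> bool" where
  "rooted_dag_aut C \<sigma> \<longleftrightarrow>
     \<sigma> permutes gates C \<and>
     (\<forall>g\<in>gates C. \<forall>h\<in>gates C. (\<sigma> g, \<sigma> h) \<in> wires C \<longleftrightarrow> (g, h) \<in> wires C) \<and>
     \<sigma> (root_gate C) = root_gate C"

definition extends_to :: "'g circuit \<Rightarrow> (nat \<Rightarrow> nat) \<Rightarrow> ('g \<Rightarrow> 'g) \<Rightarrow> bool" where
  "extends_to C \<pi> \<sigma> \<longleftrightarrow>
     rooted_dag_aut C \<sigma> \<and>
     (\<forall>g\<in>input_gates C. elabel C (\<sigma> g) = act_edge \<pi> (elabel C g))"

definition circuit_aut :: "nat \<Rightarrow> 'g circuit \<Rightarrow> ('g \<Rightarrow> 'g) set" where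
  "circuit_aut n C = {\<sigma>. \<exists>\<pi>. \<pi> permutes {..<n} \<and> extends_to C \<pi> \<sigma>}"

text \<open>\<open>stab_orbit n C g h\<close> is the orbit of \<open>h\<close> under the stabiliser of \<open>g\<close>.\<close>

definition stab_orbit :: "nat \<Rightarrow> 'g circuit \<Rightarrow> 'g \<Rightarrow> 'g \<Rightarrow> 'g set" where
  "stab_orbit n C g h = {\<sigma> h | \<sigma>. \<sigma> \<in> circuit_aut n C \<and> \<sigma> g = g}"

end

theory Submission
  imports Defs "HOL-Combinatorics.Cycles" "HOL-Real_Asymp.Real_Asymp"
begin

text \<open>Let \<open>g\<close> be a sensitive input gate with label \<open>{u, v}\<close>, and let \<open>\<tau>\<close> be an involution of the
  positions that fixes \<open>u\<close> and \<open>v\<close> and moves all but at most three positions. Some extension \<open>\<sigma>\<close> of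
  \<open>\<tau>\<close> has \<open>2\<close>-power order. Sensitivity means that the number of paths from the root to \<open>g\<close> is odd,
  so \<open>\<sigma>\<close> fixes one of these paths gate by gate. For a gate \<open>h\<close> let \<open>G\<^sub>h\<close> be the group of the
  permutations of the positions that have an extension fixing \<open>h\<close>; thus \<open>\<tau> \<in> G\<^sub>h\<close> along the path.

  Let \<open>\<Omega>\<close> be the set of positions moved by \<open>\<tau>\<close>. Along the path \<open>G\<^sub>h\<close> contains the alternating group
  of \<open>\<Omega>\<close>: this holds at the root, and from a gate to its child the index is \<open>O(n)\<close>, whereas a
  subgroup of index \<open>O(n)\<close> contains the alternating group of \<open>\<Omega>\<close> minus at most one point. As \<open>\<tau>\<close>
  moves that point, it is recovered by conjugation with \<open>\<tau>\<close>. At \<open>g\<close> this is absurd as soon as \<open>u\<close>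
  has four ones and four zeros, since a \<open>3\<close>-cycle mixing ones and zeros does not stabilise \<open>{u, v}\<close>.\<close>

section \<open>Three-cycles and permutation groups\<close>

definition cyc3 :: "'a \<Rightarrow> 'a \<Rightarrow> 'a \<Rightarrow> 'a \<Rightarrow> 'a" where
  "cyc3 a b c = (\<lambda>x. if x = a then b else if x = b then c else if x = c then a else x)"

text \<open>Three-cycles generate the alternating group, so for a group \<open>H\<close> and a
  finite set \<open>A\<close> this says that \<open>H\<close> contains Alt(\<open>A\<close>). Signs
  of permutations never have to be mentioned.\<close>

definition contains_alt :: "('a \<Rightarrow> 'a) set \<Rightarrow> 'a set \<Rightarrow> bool" where
  "contains_alt H A \<longleftrightarrow> (\<forall>a\<in>A. \<forall>b\<in>A. \<forall>c\<in>A. distinct [a, b, c] \<longrightarrow> cyc3 a b c \<in> H)"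

lemma contains_altD:
  "contains_alt H A \<Longrightarrow> a \<in> A \<Longrightarrow> b \<in> A \<Longrightarrow> c \<in> A \<Longrightarrow> a \<noteq> b \<Longrightarrow> a \<noteq> c \<Longrightarrow> b \<noteq> c \<Longrightarrow> cyc3 a b c \<in> H"
  by (auto simp: contains_alt_def)

lemma contains_alt_mono: "contains_alt H A \<Longrightarrow> B \<subseteq> A \<Longrightarrow> contains_alt H B"
  unfolding contains_alt_def by blast

lemma cyc3_simps [simp]:
  "cyc3 a b c a = b"
  "b \<noteq> a \<Longrightarrow> cyc3 a b c b = c"
  "c \<noteq> a \<Longrightarrow> c \<noteq> b \<Longrightarrow> cyc3 a b c c = a"
  "x \<noteq> a \<Longrightarrow> x \<noteq> b \<Longrightarrow> x \<noteq> c \<Longrightarrow> cyc3 a b c x = x"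
  by (auto simp: cyc3_def)

lemma cyc3_rotate: "distinct [a, b, c] \<Longrightarrow> cyc3 b c a = cyc3 a b c"
  by (auto simp: cyc3_def fun_eq_iff)

lemma cyc3_square: "distinct [a, b, c] \<Longrightarrow> cyc3 a b c \<circ> cyc3 a b c = cyc3 a c b"
  by (auto simp: cyc3_def fun_eq_iff)

lemma cyc3_eq_transpose_comp: "distinct [a, b, c] \<Longrightarrow> cyc3 a b c = transpose a b \<circ> transpose b c"
  by (auto simp: cyc3_def transpose_def fun_eq_iff)

lemma cyc3_permutes: "{a, b, c} \<subseteq> S \<Longrightarrow> distinct [a, b, c] \<Longrightarrow> cyc3 a b c permutes S"
  by (simp add: cyc3_eq_transpose_comp permutes_compose permutes_swap_id)

lemma cyc3_conj:
  assumes "bij h"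
  shows "h \<circ> cyc3 a b c \<circ> inv h = cyc3 (h a) (h b) (h c)"
proof
  fix x
  obtain y where "x = h y" using assms by (metis bij_pointE)
  then show "(h \<circ> cyc3 a b c \<circ> inv h) x = cyc3 (h a) (h b) (h c) x"
    using assms by (auto simp: cyc3_def bij_is_inj inj_eq)
qed

text \<open>The supports meet only in \<open>c\<close>, so \<open>u\<close> fixes \<open>t c\<close>
  and \<open>t\<close> fixes \<open>u c\<close>. Away from \<open>c\<close>, \<open>t c\<close> and
  \<open>u c\<close> only one of the two permutations acts along the way, and it cancels against its
  inverse.\<close>

lemma commutator_eq_cyc3:
  assumes "bij t" "bij u" and meet: "\<And>x. t x \<noteq> x \<Longrightarrow> u x \<noteq> x \<Longrightarrow> x = c"
    and tc: "t c \<noteq> c" and uc: "u c \<noteq> c"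
  shows "t \<circ> u \<circ> inv t \<circ> inv u = cyc3 c (t c) (u c)" and "t c \<noteq> u c"
proof -
  have t: "t x = y \<longleftrightarrow> x = inv t y" and u: "u x = y \<longleftrightarrow> x = inv u y" for x y
    using assms(1,2) by (metis bij_inv_eq_iff)+
  have inj: "t x = t y \<longleftrightarrow> x = y" "u x = u y \<longleftrightarrow> x = y" for x y
    using assms(1,2) by (auto simp: bij_is_inj inj_eq)
  have utc: "u (t c) = t c" using meet[of "t c"] tc inj by metis
  have tuc: "t (u c) = u c" using meet[of "u c"] uc inj by metis
  show tcuc: "t c \<noteq> u c" using utc tc inj by metis
  have "t (u (inv t (inv u x))) = cyc3 c (t c) (u c) x" for x
  proof -
    \<comment> \<open>Writing \<open>x\<close> as \<open>u (t z)\<close> removes the inverses. The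
      first three cases below are \<open>x = t c\<close>, \<open>x = u c\<close> and
      \<open>x = c\<close>.\<close>
    define z where "z = inv t (inv u x)"
    have x: "x = u (t z)" unfolding z_def by (metis t u)
    consider "z = c" | "t z = c" | "u (t z) = c" | "z \<noteq> c" "t z \<noteq> c" "u (t z) \<noteq> c" by blast
    then have "t (u z) = cyc3 c (t c) (u c) (u (t z))"
    proof cases
      case 1
      then show ?thesis using utc tuc tc by simp
    next
      case 2
      then have "u z = z" using meet tc by metis
      then show ?thesis using 2 tcuc uc by simp
    next
      case 3
      then have "t z = z" using meet[of "t z"] uc inj by metis
      then show ?thesis using 3 by simp
    next
      case 4
      show ?thesis
      proof (cases "t z = z")
        case True
        then have "t (u z) = u z" using meet[of "u z"] 4 inj by metis
        moreover have "u z \<noteq> t c" using True utc tc inj by metis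
        ultimately show ?thesis using True 4 inj by simp
      next
        case False
        then have "u z = z" "u (t z) = t z" using meet[of z] meet[of "t z"] 4 inj by metis+
        moreover have "t z \<noteq> u c" "t z \<noteq> t c" using False tuc 4(1) inj by metis+
        ultimately show ?thesis using 4(2) cyc3_simps(4)[of "t z" c "t c" "u c"] by metis
      qed
    qed
    then have "t (u z) = cyc3 c (t c) (u c) x" by (simp only: x)
    then show ?thesis by (simp only: z_def)
  qed
  then show "t \<circ> u \<circ> inv t \<circ> inv u = cyc3 c (t c) (u c)" by auto
qed

locale perm_group =
  fixes S :: "'a set" and H :: "('a \<Rightarrow> 'a) set"
  assumes permutes: "h \<in> H \<Longrightarrow> h permutes S"
    and comp: "h \<in> H \<Longrightarrow> k \<in> H \<Longrightarrow> h \<circ> k \<in> H"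
    and inverse: "h \<in> H \<Longrightarrow> inv h \<in> H"
begin

lemma bij: "h \<in> H \<Longrightarrow> bij h"
  using permutes permutes_bij by blast

lemma conj_cyc3: "h \<in> H \<Longrightarrow> cyc3 a b c \<in> H \<Longrightarrow> cyc3 (h a) (h b) (h c) \<in> H"
  using cyc3_conj[OF bij, of h a b c] comp inverse by metis

lemma contains_alt_image:
  assumes "contains_alt H A" "h \<in> H"
  shows "contains_alt H (h ` A)"
  using assms conj_cyc3 by (fastforce simp: contains_alt_def)

text \<open>The cycles through the pair \<open>a\<close>, \<open>b\<close> yield all the others:
  squaring inverts a three-cycle, and conjugating one of these cycles by another replaces
  \<open>a\<close> or \<open>b\<close> by a further point.\<close>

lemma contains_altI:
  assumes ab: "a \<noteq> b" "\<And>x. x \<in> A \<Longrightarrow> x \<noteq> a \<Longrightarrow> x \<noteq> b \<Longrightarrow> cyc3 a b x \<in> H"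
  shows "contains_alt H A"
proof -
  have inv3: "cyc3 y x z \<in> H" if "cyc3 x y z \<in> H" "distinct [x, y, z]" for x y z
    using that comp[of "cyc3 x y z" "cyc3 x y z"] cyc3_square[of x y z] cyc3_rotate[of y x z] by auto
  have b: "cyc3 b x y \<in> H" if "x \<in> A" "y \<in> A" "distinct [a, b, x, y]" for x y
    using conj_cyc3[OF ab(2)[of x] ab(2)[of y]] that ab(1) by auto
  have ba: "cyc3 b a x \<in> H" if "x \<in> A" "x \<noteq> a" "x \<noteq> b" for x
    using ab that inv3[of a b x] by auto
  have a: "cyc3 a x y \<in> H" if "x \<in> A" "y \<in> A" "distinct [a, b, x, y]" for x y
    using conj_cyc3[OF ba[of x] ba[of y]] that ab(1) by auto
  have n: "cyc3 x y z \<in> H" if "x \<in> A" "y \<in> A" "z \<in> A" "distinct [a, b, x, y, z]" for x y z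
  proof -
    have "cyc3 (cyc3 a b x b) (cyc3 a b x y) (cyc3 a b x z) \<in> H"
      using conj_cyc3[OF ab(2)[of x] b[of y z]] that by auto
    then show ?thesis using that ab(1) by auto
  qed
  show ?thesis unfolding contains_alt_def
  proof (intro ballI impI)
    fix x y z assume *: "x \<in> A" "y \<in> A" "z \<in> A" "distinct [x, y, z]"
    show "cyc3 x y z \<in> H"
    proof (cases "a \<in> {x, y, z}")
      case aT: True
      show ?thesis
      proof (cases "b \<in> {x, y, z}")
        case True
        then show ?thesis using aT * ab(1) ab(2)[of x] ab(2)[of y] ab(2)[of z]
            ba[of x] ba[of y] ba[of z] cyc3_rotate[of x y z] cyc3_rotate[of y z x] by auto
      next
        case False
        then show ?thesis using aT * ab(1) a[of x y] a[of y z] a[of z x]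
            cyc3_rotate[of x y z] cyc3_rotate[of y z x] by auto
      qed
    next
      case aF: False
      show ?thesis
      proof (cases "b \<in> {x, y, z}")
        case True
        then show ?thesis using aF * ab(1) b[of x y] b[of y z] b[of z x]
            cyc3_rotate[of x y z] cyc3_rotate[of y z x] by auto
      next
        case False
        then show ?thesis using aF * ab(1) n[of x y z] by auto
      qed
    qed
  qed
qed

lemma commutator_in:
  assumes "t \<in> H" "u \<in> H" "\<And>x. t x \<noteq> x \<Longrightarrow> u x \<noteq> x \<Longrightarrow> x = c" "t c \<noteq> c" "u c \<noteq> c"
  shows "cyc3 c (t c) (u c) \<in> H"
  using commutator_eq_cyc3(1)[OF bij bij, of t u c] assms comp inverse by metis

text \<open>With two common points, all cycles through that pair are at hand. With a single common
  point \<open>z\<close>, the cycle \<open>cyc3 z a x\<close> is the commutator of a cycle of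
  \<open>A\<close> and a cycle of \<open>B\<close>; their third points \<open>a'\<close> and
  \<open>x'\<close> exist because both sets have at least three points.\<close>

lemma contains_alt_Un:
  assumes A: "contains_alt H A" "3 \<le> card A" and B: "contains_alt H B" "3 \<le> card B"
    and "A \<inter> B \<noteq> {}"
  shows "contains_alt H (A \<union> B)"
proof -
  obtain z where z: "z \<in> A" "z \<in> B" using assms by auto
  show ?thesis
  proof (cases "\<exists>a\<in>A \<inter> B. a \<noteq> z")
    case True
    then obtain a where "a \<in> A" "a \<in> B" "a \<noteq> z" by auto
    then show ?thesis using z contains_altD[OF A(1), of z a] contains_altD[OF B(1), of z a]
      by (intro contains_altI[of z a]) auto
  next
    case False
    have "card (A - {z}) \<ge> 2" using A z by (simp add: card_Diff_singleton)
    then obtain a a' where a: "a \<in> A" "a' \<in> A" "distinct [z, a, a']"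
      by (auto simp: numeral_2_eq_2 card_le_Suc_iff)
    have fx: "cyc3 z a x \<in> H" if x: "x \<in> B" "x \<noteq> z" for x
    proof -
      have "card (B - {z,x}) \<ge> 1" using B z that by (simp add: card_Diff_subset)
      then obtain x' where x': "x' \<in> B" "distinct [z, x, x']"
        using x by (auto simp: card_le_Suc_iff)
      have "cyc3 z a a' \<in> H" "cyc3 z x x' \<in> H"
        using contains_altD[OF A(1), of z a a'] contains_altD[OF B(1), of z x x'] a x x' z by auto
      moreover have "y = z" if "cyc3 z a a' y \<noteq> y" "cyc3 z x x' y \<noteq> y" for y
      proof -
        have "y \<in> {z, a, a'}" "y \<in> {z, x, x'}"
          using that cyc3_simps(4)[of y z a a'] cyc3_simps(4)[of y z x x'] by blast+
        moreover have "w \<notin> B" if "w \<in> {a, a'}" for w using that a False by auto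
        ultimately show ?thesis using x x' by blast
      qed
      ultimately have "cyc3 z (cyc3 z a a' z) (cyc3 z x x' z) \<in> H"
        by (rule commutator_in) (use a x in auto)
      then show ?thesis by simp
    qed
    show ?thesis
    proof (rule contains_altI)
      show "z \<noteq> a" using a by simp
      show "cyc3 z a x \<in> H" if "x \<in> A \<union> B" "x \<noteq> z" "x \<noteq> a" for x
        using that fx contains_altD[OF A(1), of z a x] z a by auto
    qed
  qed
qed

end

section \<open>Subgroups of small index\<close>

text \<open>For groups \<open>H \<subseteq> G\<close> this says that the index of \<open>H\<close> in \<open>G\<close> is at most \<open>m\<close>, phrased
  as a pigeonhole principle to avoid cosets.\<close>

definition index_le :: "nat \<Rightarrow> ('a \<Rightarrow> 'a) set \<Rightarrow> ('a \<Rightarrow> 'a) set \<Rightarrow> bool" where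
  "index_le m G H \<longleftrightarrow>
     (\<forall>X. finite X \<longrightarrow> X \<subseteq> G \<longrightarrow> m < card X \<longrightarrow> (\<exists>x\<in>X. \<exists>y\<in>X. x \<noteq> y \<and> inv x \<circ> y \<in> H))"

context perm_group
begin

lemma double_transposition_in:
  assumes "contains_alt H A" "{a, b, c, d} \<subseteq> A" "distinct [a, b, c, d]"
  shows "transpose a b \<circ> transpose c d \<in> H"
proof -
  have "transpose a b \<circ> transpose c d = cyc3 a b c \<circ> cyc3 b c d"
    using assms(3) by (auto simp: fun_eq_iff cyc3_def transpose_def)
  then show ?thesis
    using comp contains_altD[OF assms(1)] assms(2,3) by simp
qed

end

text \<open>Pigeonhole on the double transpositions (\<open>c\<close>
  \<open>a\<close>)(\<open>d\<close> \<open>b\<close>) with \<open>a\<close> in \<open>P\<close> and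
  \<open>b\<close> in \<open>Q\<close>: all lie in \<open>G\<close>, and there are more than
  \<open>m\<close> of them. Hence two have their quotient in \<open>H\<close>, and this quotient
  moves \<open>c\<close> into \<open>P\<close> if their first coordinates differ, and
  \<open>d\<close> into \<open>Q\<close> otherwise.\<close>

lemma small_index_moves:
  assumes G: "perm_group S G" and alt: "contains_alt G \<Omega>" and idx: "index_le m G H"
    and sub: "P \<subseteq> \<Omega>" "Q \<subseteq> \<Omega>" "c \<in> \<Omega>" "d \<in> \<Omega>"
    and dis: "P \<inter> Q = {}" "c \<notin> P \<union> Q" "d \<notin> P \<union> Q" "c \<noteq> d"
    and fin: "finite P" "finite Q" and m: "m < card P * card Q"
  shows "\<exists>t\<in>H. (\<forall>z. z \<notin> P \<union> Q \<union> {c, d} \<longrightarrow> t z = z) \<and> (t c \<in> P \<or> t d \<in> Q)"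
proof -
  define x where "x = (\<lambda>(a, b). transpose c a \<circ> transpose d b)"
  have img: "x (a, b) c = a" "x (a, b) d = b" if "a \<in> P" "b \<in> Q" for a b
    using that dis by (auto simp: x_def transpose_def)
  have inj: "inj_on x (P \<times> Q)"
    by (rule inj_onI) (metis img SigmaE)
  have "x (a, b) \<in> G" if "a \<in> P" "b \<in> Q" for a b
    using perm_group.double_transposition_in[OF G alt, of c a d b] sub dis that
    by (auto simp: x_def)
  then have "x ` (P \<times> Q) \<subseteq> G" by auto
  moreover have "card (x ` (P \<times> Q)) = card P * card Q"
    using inj by (simp add: card_image card_cartesian_product)
  ultimately have "\<exists>u\<in>x ` (P \<times> Q). \<exists>v\<in>x ` (P \<times> Q). u \<noteq> v \<and> inv u \<circ> v \<in> H"
    using idx[unfolded index_le_def, rule_format, of "x ` (P \<times> Q)"] fin m by (metis finite_SigmaI finite_imageI)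
  then obtain a b a' b' where ab: "a \<in> P" "b \<in> Q" "a' \<in> P" "b' \<in> Q"
    "(a, b) \<noteq> (a', b')" "inv (x (a, b)) \<circ> x (a', b') \<in> H"
    by blast
  have "x (a, b) \<circ> x (a, b) = id"
    using ab dis by (auto simp: x_def transpose_def fun_eq_iff)
  then have inv: "inv (x (a, b)) = x (a, b)"
    by (rule inv_unique_comp) fact
  define t where "t = x (a, b) \<circ> x (a', b')"
  have "t z = z" if "z \<notin> P \<union> Q \<union> {c, d}" for z
    using that ab by (auto simp: t_def x_def transpose_def)
  moreover have "t c \<in> P \<or> t d \<in> Q"
    using ab dis by (auto simp: t_def x_def transpose_def)
  ultimately show ?thesis using ab(6) inv t_def by metis
qed

text \<open>The bound \<open>4 * q + 3\<close> makes room for four disjoint sets of \<open>q\<close>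
  points, a pair of them for each of two disjoint uses of \<open>small_index_moves\<close>, and for
  three spare points from which the two special points of each use are taken.\<close>

lemma small_index_has_cyc3:
  assumes G: "perm_group S G" and alt: "contains_alt G \<Omega>" and idx: "index_le m G H"
    and H: "perm_group S H" and fin: "finite \<Omega>" and q: "m < q * q" "4 * q + 3 \<le> card \<Omega>"
  shows "\<exists>a b c. {a, b, c} \<subseteq> \<Omega> \<and> distinct [a, b, c] \<and> cyc3 a b c \<in> H"
proof -
  have pick: "\<exists>T\<subseteq>\<Omega> - X. card T = q" if "X \<subseteq> \<Omega>" "card X \<le> 3 * q" for X
  proof -
    have "card (\<Omega> - X) = card \<Omega> - card X" using that fin by (intro card_Diff_subset) (auto intro: finite_subset)
    then have "q \<le> card (\<Omega> - X)" using that q by linarith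
    then show ?thesis by (meson obtain_subset_with_card_n)
  qed
  obtain P1 where P1: "P1 \<subseteq> \<Omega>" "card P1 = q"
    using pick[of "{}"] by auto
  obtain Q1 where Q1: "Q1 \<subseteq> \<Omega> - P1" "card Q1 = q"
    using pick[of P1] P1 by auto
  obtain P2 where P2: "P2 \<subseteq> \<Omega> - (P1 \<union> Q1)" "card P2 = q"
    using pick[of "P1 \<union> Q1"] P1 Q1 card_Un_le[of P1 Q1] by auto
  obtain Q2 where Q2: "Q2 \<subseteq> \<Omega> - (P1 \<union> Q1 \<union> P2)" "card Q2 = q"
    using pick[of "P1 \<union> Q1 \<union> P2"] P1 Q1 P2 card_Un_le[of P1 Q1] card_Un_le[of "P1 \<union> Q1" P2] by auto
  have finPQ: "finite P1" "finite Q1" "finite P2" "finite Q2"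
    using P1 Q1 P2 Q2 fin by (auto intro: finite_subset)
  have "P1 \<subseteq> \<Omega>" "Q1 \<subseteq> \<Omega> - P1" "P2 \<subseteq> \<Omega> - P1 - Q1" "Q2 \<subseteq> \<Omega> - P1 - Q1 - P2"
    using P1 Q1 P2 Q2 by auto
  then have "card (\<Omega> - P1 - Q1 - P2 - Q2) = card \<Omega> - q - q - q - q"
    using finPQ P1(2) Q1(2) P2(2) Q2(2) by (simp add: card_Diff_subset)
  then have "3 \<le> card (\<Omega> - P1 - Q1 - P2 - Q2)" using q by simp
  then obtain c d e where cde: "{c, d, e} \<subseteq> \<Omega> - P1 - Q1 - P2 - Q2" "distinct [c, d, e]"
    by (auto simp: numeral_3_eq_3 card_le_Suc_iff)
  \<comment> \<open>Two elements of \<open>H\<close> whose supports meet in one point have a three-cycle as commutator. The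
    supports lie in the disjoint sets \<open>P1 \<union> Q1\<close> and \<open>P2 \<union> Q2\<close> up to one or two of the points
    \<open>c, d, e\<close>; a case distinction finds two that share exactly one of these.\<close>
  define mv where "mv D X \<longleftrightarrow> (\<exists>t\<in>H. (\<forall>z\<in>X. t z \<noteq> z) \<and> (\<forall>z. z \<notin> D \<union> X \<longrightarrow> t z = z))" for D X
  have mvI: "mv (P \<union> Q) {x} \<or> mv (P \<union> Q) {y} \<or> mv (P \<union> Q) {x, y}"
    if PQ: "(P, Q) \<in> {(P1, Q1), (P2, Q2)}" and xy: "{x, y} \<subseteq> {c, d, e}" "x \<noteq> y" for P Q x y
  proof -
    have *: "x \<in> \<Omega>" "y \<in> \<Omega>" "x \<notin> P \<union> Q" "y \<notin> P \<union> Q" "P \<subseteq> \<Omega>" "Q \<subseteq> \<Omega>" "P \<inter> Q = {}"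
      "finite P" "finite Q" "m < card P * card Q"
      using PQ xy cde P1 Q1 P2 Q2 finPQ q by auto
    obtain t where t: "t \<in> H" "\<forall>z. z \<notin> P \<union> Q \<union> {x, y} \<longrightarrow> t z = z" "t x \<in> P \<or> t y \<in> Q"
      using small_index_moves[OF G alt idx, of P Q x y] * xy(2) by blast
    have "t x \<noteq> x \<or> t y \<noteq> y" using t(3) * by auto
    then show ?thesis using t(1,2) unfolding mv_def by (smt (verit) UnCI UnE empty_iff insert_iff)
  qed
  define D1 D2 where "D1 = P1 \<union> Q1" and "D2 = P2 \<union> Q2"
  have mv1: "mv D1 {x} \<or> mv D1 {y} \<or> mv D1 {x, y}" and mv2: "mv D2 {x} \<or> mv D2 {y} \<or> mv D2 {x, y}"
    if "{x, y} \<subseteq> {c, d, e}" "x \<noteq> y" for x y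
    using mvI[of P1 Q1 x y] mvI[of P2 Q2 x y] that unfolding D1_def D2_def by auto
  have disj: "D1 \<inter> D2 = {}" "D1 \<subseteq> \<Omega>" "D2 \<subseteq> \<Omega>" "{c, d, e} \<inter> (D1 \<union> D2) = {}"
    using P1 Q1 P2 Q2 cde unfolding D1_def D2_def by auto
  have key: ?thesis if mv: "mv D1 X" "mv D2 Y" and XY: "X \<inter> Y = {z}" "X \<union> Y \<subseteq> {c, d, e}" for X Y z
  proof -
    obtain t where t: "t \<in> H" "\<forall>z\<in>X. t z \<noteq> z" "\<forall>z. z \<notin> D1 \<union> X \<longrightarrow> t z = z"
      using mv unfolding mv_def by blast
    obtain u where u: "u \<in> H" "\<forall>z\<in>Y. u z \<noteq> z" "\<forall>z. z \<notin> D2 \<union> Y \<longrightarrow> u z = z"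
      using mv unfolding mv_def by blast
    have z: "t z \<noteq> z" "u z \<noteq> z" "z \<in> \<Omega>" using t u XY cde by auto
    have meet: "x = z" if "t x \<noteq> x" "u x \<noteq> x" for x
    proof -
      have "x \<in> D1 \<union> X" "x \<in> D2 \<union> Y" using t(3) u(3) that by blast+
      moreover have "D1 \<inter> Y = {}" "D2 \<inter> X = {}" using disj(4) XY(2) by auto
      ultimately have "x \<in> X \<inter> Y" using disj(1) by auto
      then show ?thesis using XY(1) by simp
    qed
    have bij: "bij t" "bij u" using H t u by (auto dest: perm_group.bij)
    have "t (t z) \<noteq> t z" "u (u z) \<noteq> u z" using bij z by (auto simp: bij_is_inj inj_eq)
    then have "t z \<in> D1 \<union> X" "u z \<in> D2 \<union> Y" using t(3) u(3) by blast+
    then have "t z \<in> \<Omega>" "u z \<in> \<Omega>" using disj XY cde by auto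
    then show ?thesis
      using commutator_eq_cyc3(2)[OF bij meet] perm_group.commutator_in[OF H t(1) u(1) meet] z
      by (intro exI[of _ z] exI[of _ "t z"] exI[of _ "u z"]) auto
  qed
  show ?thesis
  proof (rule ccontr)
    assume no: "\<not> ?thesis"
    have ne: "c \<noteq> d" "c \<noteq> e" "d \<noteq> e" "d \<noteq> c" "e \<noteq> c" "e \<noteq> d" using cde by auto
    have A: "\<not> (mv D1 {x} \<and> mv D2 {x})" if "x \<in> {c, d, e}" for x
      using no key[of "{x}" "{x}" x] that by blast
    have B: "\<not> (mv D1 {x} \<and> mv D2 {x, y})" "\<not> (mv D1 {x, y} \<and> mv D2 {x})"
      if "{x, y} \<subseteq> {c, d, e}" for x y
      using no key[of "{x}" "{x, y}" x] key[of "{x, y}" "{x}" x] that by blast+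
    have C: "\<not> (mv D1 {x, y} \<and> mv D2 {x, w})" if "{x, y, w} = {c, d, e}" "distinct [x, y, w]" for x y w
      using no key[of "{x, y}" "{x, w}" x] that by auto
    show False
      using mv1[of c d] mv1[of c e] mv1[of d e] mv2[of c d] mv2[of c e] mv2[of d e]
        A[of c] A[of d] A[of e] B[of c d] B[of d c] B[of c e] B[of e c] B[of d e] B[of e d]
        C[of c d e] ne by (auto simp: insert_commute)
  qed
qed

text \<open>Take \<open>A\<close> as large as possible. An element of \<open>H\<close> supported in
  \<Omega> with a fixed point in \<open>A\<close> must preserve \<open>A\<close>, yet
  \<open>small_index_moves\<close> supplies one that does not if \<open>A\<close> has at most
  \<open>2 * q\<close> points or misses two points.\<close>

lemma small_index_contains_alt:
  assumes G: "perm_group S G" and alt: "contains_alt G \<Omega>" and idx: "index_le m G H"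
    and H: "perm_group S H" and fin: "finite \<Omega>" and q: "m < q * q" "4 * q + 3 \<le> card \<Omega>"
  shows "\<exists>A\<subseteq>\<Omega>. card \<Omega> \<le> card A + 1 \<and> contains_alt H A"
proof -
  interpret H: perm_group S H by fact
  obtain a b c where abc: "{a, b, c} \<subseteq> \<Omega>" "distinct [a, b, c]" "cyc3 a b c \<in> H"
    using small_index_has_cyc3[OF assms] by blast
  define good where "good A \<longleftrightarrow> A \<subseteq> \<Omega> \<and> 3 \<le> card A \<and> contains_alt H A" for A
  have "contains_alt H {a, b, c}"
    using abc by (intro H.contains_altI[of a b]) auto
  then have "good {a, b, c}" using abc by (auto simp: good_def)
  moreover have "card A \<le> card \<Omega>" if "good A" for A
    using that fin by (auto simp: good_def card_mono)
  ultimately have "\<exists>A. good A \<and> (\<forall>B. good B \<longrightarrow> card B \<le> card A)"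
    using ex_has_greatest_nat[of good "{a, b, c}" card "Suc (card \<Omega>)"] by (simp add: less_Suc_eq_le)
  then obtain A where A: "good A" and max: "\<And>B. good B \<Longrightarrow> card B \<le> card A" by blast
  then have A': "A \<subseteq> \<Omega>" "3 \<le> card A" "contains_alt H A" and finA: "finite A"
    using fin by (auto simp: good_def finite_subset)
  \<comment> \<open>The image of \<open>A\<close> under \<open>t\<close> meets \<open>A\<close> in
    \<open>w\<close>, so the union of both is good again, and by maximality it equals
    \<open>A\<close>.\<close>
  have stable: "t ` A = A" if t: "t \<in> H" "\<And>z. z \<notin> \<Omega> \<Longrightarrow> t z = z" and w: "w \<in> A" "t w = w" for t w
  proof -
    have inj: "inj t" using H.bij t(1) by (simp add: bij_is_inj)
    have "t z \<in> \<Omega>" if "z \<in> \<Omega>" for z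
      using t(2) inj that by (metis injD)
    then have sub: "t ` A \<subseteq> \<Omega>" using A' by blast
    have card: "card (t ` A) = card A" using inj by (simp add: card_image inj_on_subset)
    have "t ` A \<inter> A \<noteq> {}" using w by (metis disjoint_iff imageI)
    then have "contains_alt H (t ` A \<union> A)"
      using H.contains_alt_Un H.contains_alt_image A' t(1) card by metis
    then have "good (t ` A \<union> A)"
      using sub A' finA card_mono[of "t ` A \<union> A" A] by (simp add: good_def)
    then have "card (t ` A \<union> A) \<le> card A" by (rule max)
    then have "t ` A \<union> A = A" using finA by (metis card_seteq finite_Un finite_imageI sup_ge2)
    then show ?thesis using card finA by (metis card_subset_eq sup.cobounded1)
  qed
  \<comment> \<open>Otherwise \<open>P\<close> and \<open>D - P\<close> can be chosen outside
    \<open>A\<close>, and \<open>t\<close> moves \<open>c\<close> or \<open>d\<close> out of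
    \<open>A\<close> while fixing the third point \<open>e\<close> of \<open>A\<close>.\<close>
  have big: "2 * q < card A"
  proof (rule ccontr)
    assume "\<not> 2 * q < card A"
    then have "2 * q \<le> card (\<Omega> - A)" using q A' finA by (simp add: card_Diff_subset)
    then obtain D where D: "D \<subseteq> \<Omega> - A" "card D = 2 * q" by (rule obtain_subset_with_card_n)
    obtain P where P: "P \<subseteq> D" "card P = q"
      using obtain_subset_with_card_n[of q D] D by auto
    have finD: "finite D" "finite P" using D P fin by (auto intro: finite_subset)
    obtain c d e where cde: "{c, d, e} \<subseteq> A" "distinct [c, d, e]"
      using A'(2) by (auto simp: numeral_3_eq_3 card_le_Suc_iff)
    have "card (D - P) = q" using D P finD by (simp add: card_Diff_subset)
    then obtain t where t: "t \<in> H" "\<forall>z. z \<notin> P \<union> (D - P) \<union> {c, d} \<longrightarrow> t z = z"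
      "t c \<in> P \<or> t d \<in> D - P"
      using small_index_moves[OF G alt idx, of P "D - P" c d] D P cde A' q(1) finD by auto
    have "t ` A = A"
    proof (rule stable[OF t(1)])
      show "t z = z" if "z \<notin> \<Omega>" for z
        using that t(2) cde A'(1) D P by blast
      show e: "e \<in> A" using cde by simp
      then have "e \<notin> P \<union> (D - P) \<union> {c, d}" using cde(2) D P by auto
      then show "t e = e" using t(2) by blast
    qed
    then show False using t(3) cde D P by blast
  qed
  \<comment> \<open>The reverse situation: \<open>c\<close> and \<open>d\<close> lie outside
    \<open>A\<close>, and \<open>t\<close> carries one of them into \<open>A\<close>. By
    \<open>big\<close>, some point \<open>e\<close> of \<open>A\<close> remains outside
    \<open>D\<close> and is fixed.\<close>
  have "\<not> 2 \<le> card (\<Omega> - A)"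
  proof
    assume "2 \<le> card (\<Omega> - A)"
    then obtain c d where cd: "{c, d} \<subseteq> \<Omega> - A" "c \<noteq> d"
      by (auto simp: numeral_2_eq_2 card_le_Suc_iff)
    obtain D where D: "D \<subseteq> A" "card D = 2 * q"
      using obtain_subset_with_card_n[of "2 * q" A] big by auto
    obtain P where P: "P \<subseteq> D" "card P = q"
      using obtain_subset_with_card_n[of q D] D by auto
    have finD: "finite D" "finite P" using D P finA by (auto intro: finite_subset)
    obtain e where e: "e \<in> A" "e \<notin> D" using D big by (metis less_irrefl subsetI subset_antisym)
    have "card (D - P) = q" using D P finD by (simp add: card_Diff_subset)
    then obtain t where t: "t \<in> H" "\<forall>z. z \<notin> P \<union> (D - P) \<union> {c, d} \<longrightarrow> t z = z"
      "t c \<in> P \<or> t d \<in> D - P"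
      using small_index_moves[OF G alt idx, of P "D - P" c d] D P cd A' q(1) finD by auto
    have "t ` A = A"
    proof (rule stable[OF t(1) _ e(1)])
      show "t z = z" if "z \<notin> \<Omega>" for z
        using that t(2) cd A'(1) D P by blast
      show "t e = e" using t(2) e cd P by auto
    qed
    moreover have "inj t" using H.bij t(1) by (simp add: bij_is_inj)
    ultimately show False using t(3) cd D P by (metis DiffD1 DiffD2 inj_image_mem_iff insert_subset subsetD)
  qed
  then have "card \<Omega> \<le> card A + 1" using A' finA fin by (simp add: card_Diff_subset)
  then show ?thesis using A' by blast
qed

text \<open>At most one point is missing from the set \<open>A\<close> of
  \<open>small_index_contains_alt\<close>, and \<tau> carries it into \<open>A\<close>. So
  \<open>A\<close> and its image under \<tau> cover \<Omega>, and they overlap because twice the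
  size of \<open>A\<close> exceeds that of \<Omega>.\<close>

lemma small_index_contains_alt_involution:
  assumes G: "perm_group S G" and alt: "contains_alt G \<Omega>" and idx: "index_le m G H"
    and H: "perm_group S H" and fin: "finite \<Omega>" and q: "m < q * q" "4 * q + 3 \<le> card \<Omega>"
    and \<tau>: "\<tau> \<in> H" "\<tau> \<circ> \<tau> = id" "\<And>x. x \<in> \<Omega> \<Longrightarrow> \<tau> x \<in> \<Omega> \<and> \<tau> x \<noteq> x"
  shows "contains_alt H \<Omega>"
proof -
  interpret H: perm_group S H by fact
  obtain A where A: "A \<subseteq> \<Omega>" "card \<Omega> \<le> card A + 1" "contains_alt H A"
    using small_index_contains_alt[OF assms(1-7)] by blast
  have finA: "finite A" using A fin finite_subset by blast
  have \<tau>\<tau>: "\<tau> (\<tau> x) = x" for x using \<tau>(2) by (metis comp_apply id_apply)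
  have "card (\<Omega> - A) \<le> 1" using A finA by (simp add: card_Diff_subset)
  then have one: "x = y" if "x \<in> \<Omega> - A" "y \<in> \<Omega> - A" for x y
    using that fin by (metis card_le_Suc0_iff_eq finite_Diff One_nat_def)
  \<comment> \<open>Hence \<Omega> has at least 7 points, which makes \<open>A\<close> large enough
    for the overlap and for \<open>contains_alt_Un\<close>.\<close>
  have q0: "q \<noteq> 0" using q by (metis less_nat_zero_code mult_0)
  have card: "card (\<tau> ` A) = card A" using \<tau>\<tau> by (intro card_image inj_onI) metis
  have sub: "\<Omega> \<subseteq> A \<union> \<tau> ` A"
  proof
    fix x assume x: "x \<in> \<Omega>"
    show "x \<in> A \<union> \<tau> ` A"
    proof (cases "x \<in> A")
      case False
      then have "\<tau> x \<in> A" using one[of x "\<tau> x"] x \<tau>(3)[of x] by fastforce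
      then show ?thesis using \<tau>\<tau> by (metis UnI2 imageI)
    qed simp
  qed
  have "A \<inter> \<tau> ` A \<noteq> {}"
  proof
    assume "A \<inter> \<tau> ` A = {}"
    then have "card (A \<union> \<tau> ` A) = card A + card A" using finA card by (simp add: card_Un_disjoint)
    moreover have "card (A \<union> \<tau> ` A) \<le> card \<Omega>" using A(1) \<tau>(3) fin by (intro card_mono) auto
    ultimately show False using A(2) q(2) q0 by linarith
  qed
  then have "contains_alt H (A \<union> \<tau> ` A)"
    using A card q(2) q0 H.contains_alt_image[OF A(3) \<tau>(1)]
    by (intro H.contains_alt_Un) auto
  then show ?thesis using sub contains_alt_mono by blast
qed

section \<open>Gate stabilisers\<close>

text \<open>\<open>permute_list\<close> acts from the right; the inverse in \<open>act_vert\<close>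
  turns this into a left action.\<close>

lemma act_vert_comp:
  assumes "\<pi> permutes {..<n}" "\<rho> permutes {..<n}" "length v = n"
  shows "act_vert (\<pi> \<circ> \<rho>) v = act_vert \<pi> (act_vert \<rho> v)"
proof -
  have "inv (\<pi> \<circ> \<rho>) = inv \<rho> \<circ> inv \<pi>"
    using assms by (simp add: o_inv_distrib permutes_bij)
  then show ?thesis
    using assms by (simp add: act_vert_def permute_list_compose permutes_inv)
qed

lemma act_edge_comp:
  assumes "\<pi> permutes {..<n}" "\<rho> permutes {..<n}" "e \<in> cube_edges n"
  shows "act_edge (\<pi> \<circ> \<rho>) e = act_edge \<pi> (act_edge \<rho> e)"
  using assms act_vert_comp[OF assms(1,2)]
  by (auto simp: act_edge_def cube_edges_def cube_verts_def)

lemma act_edge_id: "act_edge id e = e"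
  by (simp add: act_edge_def act_vert_def)

lemma rooted_dag_aut_children:
  assumes "wires C \<subseteq> gates C \<times> gates C" "rooted_dag_aut C \<sigma>" "g \<in> gates C"
  shows "children C (\<sigma> g) = \<sigma> ` children C g"
proof -
  have p: "\<sigma> permutes gates C" using assms by (simp add: rooted_dag_aut_def)
  show ?thesis
  proof (intro equalityI subsetI)
    fix h assume "h \<in> children C (\<sigma> g)"
    then have h: "(\<sigma> g, h) \<in> wires C" by (simp add: children_def)
    then have "h \<in> \<sigma> ` gates C" using assms(1) permutes_image[OF p] by auto
    then show "h \<in> \<sigma> ` children C g"
      using h assms(2,3) by (auto simp: children_def rooted_dag_aut_def)
  next
    fix h assume "h \<in> \<sigma> ` children C g"
    then show "h \<in> children C (\<sigma> g)"
      using assms by (auto simp: children_def rooted_dag_aut_def)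
  qed
qed

lemma rooted_dag_aut_gates:
  assumes "rooted_dag_aut C \<sigma>"
  shows "\<sigma> g \<in> gates C \<longleftrightarrow> g \<in> gates C"
  using assms by (auto simp: rooted_dag_aut_def permutes_in_image)

lemma rooted_dag_aut_input_gates:
  assumes "wires C \<subseteq> gates C \<times> gates C" "rooted_dag_aut C \<sigma>"
  shows "\<sigma> g \<in> input_gates C \<longleftrightarrow> g \<in> input_gates C"
  using rooted_dag_aut_gates[OF assms(2)] rooted_dag_aut_children[OF assms]
  by (auto simp: input_gates_def)

lemma rooted_dag_aut_comp:
  assumes "rooted_dag_aut C \<sigma>" "rooted_dag_aut C \<sigma>'"
  shows "rooted_dag_aut C (\<sigma> \<circ> \<sigma>')"
  using assms by (auto simp: rooted_dag_aut_def permutes_compose permutes_in_image)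

lemma rooted_dag_aut_inv:
  assumes "rooted_dag_aut C \<sigma>" "root_gate C \<in> gates C"
  shows "rooted_dag_aut C (inv \<sigma>)"
proof -
  have p: "\<sigma> permutes gates C" using assms by (simp add: rooted_dag_aut_def)
  have "(inv \<sigma> g, inv \<sigma> h) \<in> wires C \<longleftrightarrow> (g, h) \<in> wires C" if "g \<in> gates C" "h \<in> gates C" for g h
    using assms(1) that permutes_inverses(1)[OF p] permutes_in_image[OF permutes_inv[OF p]]
    unfolding rooted_dag_aut_def by metis
  then show ?thesis
    using assms permutes_inv[OF p] permutes_inverses(2)[OF p]
    unfolding rooted_dag_aut_def by metis
qed

locale symmetric_circuit =
  fixes n :: nat and C :: "'g circuit"
  assumes circ: "xor_circuit n C"
    and sym: "\<pi> permutes {..<n} \<Longrightarrow> \<exists>\<sigma>. extends_to C \<pi> \<sigma>"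
begin

lemma wires: "wires C \<subseteq> gates C \<times> gates C"
  using circ by (simp add: xor_circuit_def)

lemma finite_gates: "finite (gates C)"
  using circ by (simp add: xor_circuit_def)

lemma wf_wires: "wf ((wires C)\<inverse>)"
  using circ wires finite_gates unfolding xor_circuit_def
  by (meson finite_SigmaI finite_acyclic_wf_converse finite_subset)

lemma children_gates: "h \<in> children C g \<Longrightarrow> h \<in> gates C"
  using wires by (auto simp: children_def)

lemma finite_children: "finite (children C g)"
  using children_gates finite_gates by (meson finite_subset subsetI)

lemma label_edge: "g \<in> input_gates C \<Longrightarrow> elabel C g \<in> cube_edges n"
  using circ by (auto simp: xor_circuit_def)

lemma extends_to_comp:
  assumes "\<pi> permutes {..<n}" "\<pi>' permutes {..<n}" "extends_to C \<pi> \<sigma>" "extends_to C \<pi>' \<sigma>'"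
  shows "extends_to C (\<pi> \<circ> \<pi>') (\<sigma> \<circ> \<sigma>')"
  using assms rooted_dag_aut_comp rooted_dag_aut_input_gates[OF wires] label_edge
    act_edge_comp[OF assms(1,2)]
  by (auto simp: extends_to_def)

lemma extends_to_inv:
  assumes "\<pi> permutes {..<n}" "extends_to C \<pi> \<sigma>"
  shows "extends_to C (inv \<pi>) (inv \<sigma>)"
proof -
  have aut: "rooted_dag_aut C \<sigma>" and p: "\<sigma> permutes gates C"
    using assms by (auto simp: extends_to_def rooted_dag_aut_def)
  have aut': "rooted_dag_aut C (inv \<sigma>)"
    using rooted_dag_aut_inv[OF aut] circ by (simp add: xor_circuit_def)
  have "elabel C (inv \<sigma> g) = act_edge (inv \<pi>) (elabel C g)" if g: "g \<in> input_gates C" for g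
  proof -
    have g': "inv \<sigma> g \<in> input_gates C"
      using rooted_dag_aut_input_gates[OF wires aut'] g by simp
    then have "elabel C g = act_edge \<pi> (elabel C (inv \<sigma> g))"
      using assms permutes_inverses(1)[OF p] by (metis extends_to_def)
    then show ?thesis
      using act_edge_comp[OF permutes_inv[OF assms(1)] assms(1) label_edge[OF g']]
        permutes_inv_o(2)[OF assms(1)] act_edge_id by metis
  qed
  then show ?thesis using aut' by (simp add: extends_to_def)
qed

lemma extends_to_id: "extends_to C id id"
  by (simp add: extends_to_def rooted_dag_aut_def act_edge_id permutes_id)

lemma extends_to_funpow:
  assumes "\<pi> permutes {..<n}" "extends_to C \<pi> \<sigma>"
  shows "extends_to C (\<pi> ^^ k) (\<sigma> ^^ k)"
proof (induction k)
  case 0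
  then show ?case using extends_to_id by (simp add: id_def)
next
  case (Suc k)
  then show ?case
    using extends_to_comp[OF assms(1) permutes_funpow[OF assms(1)] assms(2)]
    by (simp only: funpow.simps)
qed

text \<open>An extension need not be unique, so a member of this group may also have extensions that
  move \<open>g\<close>.\<close>

definition gate_stab :: "'g \<Rightarrow> (nat \<Rightarrow> nat) set" where
  "gate_stab g = {\<pi>. \<pi> permutes {..<n} \<and> (\<exists>\<sigma>. extends_to C \<pi> \<sigma> \<and> \<sigma> g = g)}"

lemma perm_group_gate_stab: "perm_group {..<n} (gate_stab g)"
proof
  fix h assume "h \<in> gate_stab g"
  then obtain \<sigma> where h: "h permutes {..<n}" "extends_to C h \<sigma>" "\<sigma> g = g"
    by (auto simp: gate_stab_def)
  show "h permutes {..<n}" by (rule h)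
  have "\<sigma> permutes gates C" using h by (simp add: extends_to_def rooted_dag_aut_def)
  then have "inv \<sigma> g = g" using h(3) by (metis permutes_inverses(2))
  then show "inv h \<in> gate_stab g"
    using h extends_to_inv permutes_inv unfolding gate_stab_def by blast
  fix k assume "k \<in> gate_stab g"
  then obtain \<rho> where k: "k permutes {..<n}" "extends_to C k \<rho>" "\<rho> g = g"
    by (auto simp: gate_stab_def)
  have "(\<sigma> \<circ> \<rho>) g = g" using h k by simp
  then show "h \<circ> k \<in> gate_stab g"
    using h k extends_to_comp permutes_compose unfolding gate_stab_def by blast
qed

lemma gate_stab_root: "\<pi> permutes {..<n} \<Longrightarrow> \<pi> \<in> gate_stab (root_gate C)"
  using sym[of \<pi>] unfolding gate_stab_def extends_to_def rooted_dag_aut_def by blast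

lemma gate_stab_input:
  assumes "g \<in> input_gates C" "\<pi> \<in> gate_stab g"
  shows "act_edge \<pi> (elabel C g) = elabel C g"
  using assms by (auto simp: gate_stab_def extends_to_def)

text \<open>Labels are injective, so at an input gate the choice of the extension does not matter.
  This allows an extension to be replaced by an odd power of it.\<close>

lemma extends_to_fixes_input:
  assumes "g \<in> input_gates C" "extends_to C \<pi> \<sigma>" "act_edge \<pi> (elabel C g) = elabel C g"
  shows "\<sigma> g = g"
proof -
  have "\<sigma> g \<in> input_gates C"
    using assms rooted_dag_aut_input_gates[OF wires] by (simp add: extends_to_def)
  moreover have "elabel C (\<sigma> g) = elabel C g" using assms by (simp add: extends_to_def)
  moreover have "inj_on (elabel C) (input_gates C)" using circ by (simp add: xor_circuit_def)
  ultimately show ?thesis using assms(1) by (meson inj_onD)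
qed

text \<open>Choose for every permutation an extension that fixes \<open>h\<close>. If two of these
  agree on \<open>g\<close>, their quotient fixes \<open>g\<close>, so the orbit size bounds the
  number of classes. The group of \<open>g\<close> need not lie in that of \<open>h\<close>;
  \<open>index_le\<close> then bounds the index of the intersection in
  \<open>gate_stab h\<close>.\<close>

lemma index_gate_stab:
  assumes "g \<in> gates C" "card (stab_orbit n C h g) \<le> m"
  shows "index_le m (gate_stab h) (gate_stab g)"
  unfolding index_le_def
proof (intro allI impI)
  fix X assume X: "finite X" "X \<subseteq> gate_stab h" "m < card X"
  define lift where "lift \<pi> = (SOME \<sigma>. extends_to C \<pi> \<sigma> \<and> \<sigma> h = h)" for \<pi>
  have lift: "extends_to C \<pi> (lift \<pi>)" "lift \<pi> h = h" "\<pi> permutes {..<n}" if "\<pi> \<in> X" for \<pi>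
    using that X(2) someI_ex[of "\<lambda>\<sigma>. extends_to C \<pi> \<sigma> \<and> \<sigma> h = h"]
    by (auto simp: lift_def gate_stab_def)
  have sub: "(\<lambda>\<pi>. lift \<pi> g) ` X \<subseteq> stab_orbit n C h g"
    using lift unfolding stab_orbit_def circuit_aut_def by blast
  have "stab_orbit n C h g \<subseteq> gates C"
    using assms(1) by (auto simp: stab_orbit_def circuit_aut_def extends_to_def rooted_dag_aut_gates)
  then have "card ((\<lambda>\<pi>. lift \<pi> g) ` X) \<le> card (stab_orbit n C h g)"
    using sub finite_gates by (meson card_mono finite_subset)
  then have "\<not> inj_on (\<lambda>\<pi>. lift \<pi> g) X"
    using assms(2) X(3) by (metis card_image le_trans not_le)
  then obtain x y where xy: "x \<in> X" "y \<in> X" "x \<noteq> y" "lift x g = lift y g"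
    by (auto simp: inj_on_def)
  have "lift x permutes gates C" using lift xy by (simp add: extends_to_def rooted_dag_aut_def)
  then have "(inv (lift x) \<circ> lift y) g = g"
    using xy(4) by (metis comp_apply permutes_inverses(2))
  moreover have "extends_to C (inv x \<circ> y) (inv (lift x) \<circ> lift y)"
    using lift xy extends_to_inv extends_to_comp permutes_inv by metis
  moreover have "inv x \<circ> y permutes {..<n}"
    using lift xy by (meson permutes_compose permutes_inv)
  ultimately have "inv x \<circ> y \<in> gate_stab g" unfolding gate_stab_def by blast
  then show "\<exists>x\<in>X. \<exists>y\<in>X. x \<noteq> y \<and> inv x \<circ> y \<in> gate_stab g" using xy by blast
qed

end

section \<open>Sensitivity and fixed paths\<close>

lemma even_card_involution:
  assumes "finite X" "\<And>x. x \<in> X \<Longrightarrow> f x \<in> X \<and> f (f x) = x \<and> f x \<noteq> x"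
  shows "even (card X)"
  using assms
proof (induction "card X" arbitrary: X rule: less_induct)
  case less
  show ?case
  proof (cases "X = {}")
    case False
    then obtain x where x: "x \<in> X" by auto
    define Y where "Y = X - {x, f x}"
    have fx: "f x \<in> X" "f x \<noteq> x" "f (f x) = x" using less.prems(2)[OF x] by auto
    then have card: "card X = card Y + 2"
      using x less.prems(1) card_Diff_subset[of "{x, f x}" X] card_mono[of X "{x, f x}"]
      by (auto simp: Y_def)
    have "f y \<in> Y \<and> f (f y) = y \<and> f y \<noteq> y" if "y \<in> Y" for y
      using that less.prems(2)[of y] fx by (auto simp: Y_def)
    then have "even (card Y)"
      using less.hyps[of Y] less.prems(1) card by (auto simp: Y_def)
    then show ?thesis using card by simp
  qed simp
qed

text \<open>The fixed point argument for a cyclic 2-group. In the induction step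
  \<open>f ^^ (2 ^ k)\<close> is an involution on \<open>X\<close>, so the points it moves pair off.
  Its fixed points form an odd set that \<open>f\<close> preserves, and the induction hypothesis
  applies to this set.\<close>

lemma odd_card_fixed_point:
  assumes "finite X" "odd (card X)" "f ` X \<subseteq> X" "\<And>x. x \<in> X \<Longrightarrow> (f ^^ (2 ^ k)) x = x"
  shows "\<exists>x\<in>X. f x = x"
  using assms
proof (induction k arbitrary: X)
  case 0
  then have "X \<noteq> {}" by auto
  then show ?case using 0 by auto
next
  case (Suc k)
  define h where "h = f ^^ (2 ^ k)"
  have hX: "h x \<in> X" if "x \<in> X" for x
  proof -
    have "(f ^^ j) x \<in> X" for j
      by (induction j) (use that Suc.prems(3) in auto)
    then show ?thesis by (simp add: h_def)
  qed
  have hh: "h (h x) = x" if "x \<in> X" for x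
  proof -
    have "h (h x) = (f ^^ (2 ^ k + 2 ^ k)) x" by (simp only: h_def funpow_add comp_apply)
    then show ?thesis using Suc.prems(4)[OF that] by (simp add: mult_2)
  qed
  define Y where "Y = {x \<in> X. h x = x}"
  have "even (card (X - Y))"
    using Suc.prems(1) hX hh by (intro even_card_involution[of _ h]) (auto simp: Y_def)
  moreover have "card (X - Y) = card X - card Y" "card Y \<le> card X"
    using Suc.prems(1) by (auto simp: Y_def intro!: card_Diff_subset card_mono)
  ultimately have "odd (card Y)" using Suc.prems(2) by auto
  moreover have "f ` Y \<subseteq> Y"
  proof
    fix y assume "y \<in> f ` Y"
    then obtain z where z: "y = f z" "z \<in> X" "h z = z" by (auto simp: Y_def)
    have "h (f z) = f (h z)" unfolding h_def by (rule funpow_swap1[symmetric])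
    then show "y \<in> Y" using z Suc.prems(3) by (auto simp: Y_def)
  qed
  moreover have "finite Y" "\<And>x. x \<in> Y \<Longrightarrow> (f ^^ (2 ^ k)) x = x"
    using Suc.prems(1) by (simp_all add: Y_def h_def)
  ultimately have "\<exists>x\<in>Y. f x = x" by (intro Suc.IH)
  then show ?case by (auto simp: Y_def)
qed

text \<open>Take for \<open>N\<close> the odd part of an exponent that annihilates \<sigma>. If
  \<sigma> extends an involution \<tau>, so does its odd power, since \<tau> equals its own odd
  powers.\<close>

lemma odd_power_has_two_power_order:
  assumes "\<sigma> permutes S" "finite S"
  shows "\<exists>N k. odd N \<and> (\<sigma> ^^ N) ^^ (2 ^ k) = id"
proof -
  have "permutation \<sigma>" using assms permutation_permutes by blast
  then obtain M where M: "\<sigma> ^^ M = id" "M > 0" by (rule permutation_is_nilpotent)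
  have "\<exists>N k. odd N \<and> M = N * 2 ^ k"
    using M(2)
  proof (induction M rule: less_induct)
    case (less M)
    show ?case
    proof (cases "even M")
      case True
      then obtain L where L: "M = 2 * L" by auto
      then have "\<exists>N k. odd N \<and> L = N * 2 ^ k" using less.IH[of L] less.prems by simp
      then obtain N k where "odd N" "L = N * 2 ^ k" by blast
      then have "odd N \<and> M = N * 2 ^ Suc k" using L by simp
      then show ?thesis by blast
    next
      case False
      then have "odd M \<and> M = M * 2 ^ 0" by simp
      then show ?thesis by blast
    qed
  qed
  then show ?thesis using M(1) by (metis funpow_mult mult.commute)
qed

text \<open>The parity of a symmetric difference. For an XOR gate it means that the value changes
  exactly if an odd number of children change.\<close>

lemma odd_card_filter_neq_iff:
  assumes "finite X"
  shows "(odd (card {x \<in> X. P x}) \<noteq> odd (card {x \<in> X. Q x})) \<longleftrightarrow> odd (card {x \<in> X. P x \<noteq> Q x})"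
  using assms
proof (induction X)
  case (insert a X)
  have *: "{x \<in> insert a X. R x} = (if R a then insert a {x \<in> X. R x} else {x \<in> X. R x})" for R
    by auto
  show ?case using insert unfolding * by auto
qed simp

context symmetric_circuit
begin

text \<open>An induction along a \<open>\<sigma>\<close>-fixed path from the root to \<open>g\<close>. Below a fixed gate affected by \<open>g\<close>
  an odd number of children is affected, and \<open>\<sigma>\<close>, having \<open>2\<close>-power order, fixes one of them.\<close>

lemma sensitive_fixed_path_induct:
  assumes g: "g \<in> input_gates C" and sens: "sensitive_to C g"
    and aut: "rooted_dag_aut C \<sigma>" "\<sigma> g = g" "\<sigma> ^^ (2 ^ k) = id"
    and root: "Q (root_gate C)"
    and step: "\<And>h h'. Q h \<Longrightarrow> h \<in> gates C \<Longrightarrow> h' \<in> children C h \<Longrightarrow> \<sigma> h' = h' \<Longrightarrow> Q h'"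
  shows "Q g"
proof -
  obtain x where x: "circuit_output C (x(elabel C g := \<not> x (elabel C g))) \<noteq> circuit_output C x"
    using sens by (auto simp: sensitive_to_def)
  \<comment> \<open>By \<open>leaf\<close> and \<open>inner\<close> below, \<open>D\<close> obeys on
    gates a recursion in which \<open>x\<close> no longer occurs: it is the parity of the number of
    paths from \<open>h\<close> to \<open>g\<close>. This is why \<open>D\<close> is invariant under
    \<sigma> although \<open>x\<close> need not be.\<close>
  define D where "D h \<longleftrightarrow> gate_val C (x(elabel C g := \<not> x (elabel C g))) h \<noteq> gate_val C x h" for h
  have leaf: "D h \<longleftrightarrow> h = g" if "h \<in> input_gates C" for h
  proof -
    have "elabel C h = elabel C g \<longleftrightarrow> h = g"
      using circ that g by (auto simp: xor_circuit_def dest: inj_onD)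
    then show ?thesis
      using that by (auto simp: D_def gate_val_unfold[OF circ, of _ h] input_gates_def)
  qed
  have inner: "D h \<longleftrightarrow> odd (card {h' \<in> children C h. D h'})" if "children C h \<noteq> {}" for h
    using that odd_card_filter_neq_iff[OF finite_children]
    by (simp add: D_def gate_val_unfold[OF circ, of _ h])
  have D_inv: "h \<in> gates C \<longrightarrow> D (\<sigma> h) = D h" for h
    using wf_wires
  proof (induction h rule: wf_induct_rule)
    case (less h)
    have inj: "inj \<sigma>" using aut(1) by (auto simp: rooted_dag_aut_def permutes_inj)
    show ?case
    proof
      assume h: "h \<in> gates C"
      note ch = rooted_dag_aut_children[OF wires aut(1) h]
      show "D (\<sigma> h) = D h"
      proof (cases "children C h = {}")
        case True
        then have "h \<in> input_gates C" "\<sigma> h \<in> input_gates C"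
          using h rooted_dag_aut_input_gates[OF wires aut(1)] by (auto simp: input_gates_def)
        then show ?thesis using leaf aut(2) inj by (metis injD)
      next
        case False
        have "{h' \<in> \<sigma> ` children C h. D h'} = \<sigma> ` {h' \<in> children C h. D h'}"
          using less children_gates by (auto simp: children_def)
        then have "card {h' \<in> children C (\<sigma> h). D h'} = card {h' \<in> children C h. D h'}"
          using ch inj by (simp add: card_image inj_on_subset)
        then show ?thesis using inner[of h] inner[of "\<sigma> h"] False ch by simp
      qed
    qed
  qed
  \<comment> \<open>The only affected input gate is \<open>g\<close>, so a descent through affected
    gates must end there.\<close>
  have "h \<in> gates C \<longrightarrow> D h \<longrightarrow> \<sigma> h = h \<longrightarrow> Q h \<longrightarrow> Q g" for h
    using wf_wires
  proof (induction h rule: wf_induct_rule)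
    case (less h)
    show ?case
    proof (intro impI)
      assume h: "h \<in> gates C" "D h" "\<sigma> h = h" "Q h"
      show "Q g"
      proof (cases "children C h = {}")
        case True
        then show ?thesis using leaf[of h] h by (simp add: input_gates_def)
      next
        case False
        define X where "X = {h' \<in> children C h. D h'}"
        have "\<sigma> ` X \<subseteq> X"
          using rooted_dag_aut_children[OF wires aut(1) h(1)] h(3) D_inv children_gates
          by (auto simp: X_def)
        moreover have "odd (card X)" using inner[OF False] h(2) by (simp add: X_def)
        moreover have "finite X" using finite_children by (simp add: X_def)
        ultimately obtain h' where h': "h' \<in> X" "\<sigma> h' = h'"
          using odd_card_fixed_point[of X \<sigma> k] aut(3) by auto
        have "h' \<in> children C h" "D h'" using h' by (auto simp: X_def)
        then show ?thesis
          using less[of h'] step[OF h(4,1) _ h'(2)] h'(2) children_gates by (auto simp: children_def)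
      qed
    qed
  qed
  moreover have "root_gate C \<in> gates C" using circ by (simp add: xor_circuit_def)
  moreover have "D (root_gate C)" using x by (simp add: D_def circuit_output_def)
  moreover have "\<sigma> (root_gate C) = root_gate C" using aut(1) by (simp add: rooted_dag_aut_def)
  ultimately show ?thesis using root by blast
qed

lemma sensitive_contains_alt:
  assumes g: "g \<in> input_gates C" and sens: "sensitive_to C g"
    and orb: "\<And>h h'. h \<in> gates C \<Longrightarrow> h' \<in> children C h \<Longrightarrow> card (stab_orbit n C h h') \<le> m"
    and \<tau>: "\<tau> permutes {..<n}" "\<tau> \<circ> \<tau> = id" "act_edge \<tau> (elabel C g) = elabel C g"
    and q: "m < q * q" "4 * q + 3 \<le> card {i. i < n \<and> \<tau> i \<noteq> i}"
  shows "contains_alt (gate_stab g) {i. i < n \<and> \<tau> i \<noteq> i}"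
proof -
  define \<Omega> where "\<Omega> = {i. i < n \<and> \<tau> i \<noteq> i}"
  obtain \<sigma>0 where \<sigma>0: "extends_to C \<tau> \<sigma>0" using sym \<tau>(1) by blast
  then have "\<sigma>0 permutes gates C" by (simp add: extends_to_def rooted_dag_aut_def)
  then obtain N k where N: "odd N" "(\<sigma>0 ^^ N) ^^ (2 ^ k) = id"
    using odd_power_has_two_power_order finite_gates by blast
  define \<sigma> where "\<sigma> = \<sigma>0 ^^ N"
  have "\<tau> ^^ N = \<tau>"
  proof -
    obtain j where "N = Suc (2 * j)" using N(1) by (auto elim: oddE)
    moreover have "\<tau> ^^ (2 * j) = id"
      using \<tau>(2) by (induction j) (simp_all add: fun_eq_iff)
    ultimately show ?thesis by simp
  qed
  then have \<sigma>: "extends_to C \<tau> \<sigma>"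
    using extends_to_funpow[OF \<tau>(1) \<sigma>0, of N] by (simp add: \<sigma>_def)
  have \<tau>\<tau>: "\<tau> (\<tau> i) = i" for i using \<tau>(2) by (metis comp_apply id_apply)
  have move: "\<tau> i \<in> \<Omega> \<and> \<tau> i \<noteq> i" if "i \<in> \<Omega>" for i
    using that \<tau>\<tau> permutes_in_image[OF \<tau>(1)] by (auto simp: \<Omega>_def)
  \<comment> \<open>The single extension \<sigma> serves the whole path: where it fixes a gate, it
    shows that \<tau> lies in the group of that gate, as the passage to a child requires.\<close>
  have "contains_alt (gate_stab g) \<Omega>"
  proof (rule sensitive_fixed_path_induct[OF g sens, of \<sigma> k])
    show "rooted_dag_aut C \<sigma>" using \<sigma> by (simp add: extends_to_def)
    show "\<sigma> g = g" using extends_to_fixes_input[OF g \<sigma> \<tau>(3)] .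
    show "\<sigma> ^^ (2 ^ k) = id" using N by (simp add: \<sigma>_def)
    have "cyc3 a b c \<in> gate_stab (root_gate C)" if "a < n" "b < n" "c < n" "distinct [a, b, c]" for a b c
    proof (rule gate_stab_root)
      show "cyc3 a b c permutes {..<n}" using that by (intro cyc3_permutes) auto
    qed
    then show "contains_alt (gate_stab (root_gate C)) \<Omega>"
      by (auto simp: contains_alt_def \<Omega>_def)
    show "contains_alt (gate_stab h') \<Omega>"
      if h: "contains_alt (gate_stab h) \<Omega>" "h \<in> gates C" "h' \<in> children C h" "\<sigma> h' = h'" for h h'
    proof (rule small_index_contains_alt_involution[OF perm_group_gate_stab h(1) _ perm_group_gate_stab])
      show "index_le m (gate_stab h) (gate_stab h')"
        using index_gate_stab orb h children_gates by blast
      show "finite \<Omega>" by (simp add: \<Omega>_def)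
      show "m < q * q" "4 * q + 3 \<le> card \<Omega>" using q by (auto simp: \<Omega>_def)
      show "\<tau> \<in> gate_stab h'" using \<sigma> \<tau>(1) h(4) by (auto simp: gate_stab_def)
      show "\<tau> \<circ> \<tau> = id" by (rule \<tau>)
      show "\<tau> i \<in> \<Omega> \<and> \<tau> i \<noteq> i" if "i \<in> \<Omega>" for i using move that by blast
    qed
  qed
  then show ?thesis by (simp add: \<Omega>_def)
qed

end

section \<open>Involutions that fix an edge, and edges with balanced endpoints\<close>

lemma ex_involution:
  assumes "finite A"
  shows "\<exists>\<tau>. \<tau> permutes A \<and> \<tau> \<circ> \<tau> = id \<and> card {x \<in> A. \<tau> x = x} \<le> 1"
  using assms
proof (induction "card A" arbitrary: A rule: less_induct)
  case less
  show ?case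
  proof (cases "card A \<le> 1")
    case True
    then have "card {x \<in> A. id x = x} \<le> 1" by simp
    then show ?thesis using permutes_id by (metis comp_id)
  next
    case False
    then have "Suc (Suc 0) \<le> card A" by simp
    then obtain a b where ab: "a \<in> A" "b \<in> A" "a \<noteq> b"
      by (auto simp: card_le_Suc_iff)
    define B where "B = A - {a, b}"
    have "B \<subset> A" using ab by (auto simp: B_def)
    then have "card B < card A" using less.prems by (rule psubset_card_mono[rotated])
    then obtain \<tau> where \<tau>: "\<tau> permutes B" "\<tau> \<circ> \<tau> = id" "card {x \<in> B. \<tau> x = x} \<le> 1"
      using less B_def by blast
    have fix1: "\<tau> a = a" "\<tau> b = b" using \<tau>(1) by (auto simp: permutes_def B_def)
    have inj: "\<tau> x = \<tau> y \<longleftrightarrow> x = y" for x y using \<tau>(1) by (metis permutes_inj injD)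
    have \<tau>ab: "\<tau> x = a \<longleftrightarrow> x = a" "\<tau> x = b \<longleftrightarrow> x = b" for x
      using inj[of x a] inj[of x b] fix1 by auto
    have \<tau>\<tau>: "\<tau> (\<tau> x) = x" for x using \<tau>(2) by (metis comp_apply id_apply)
    define \<rho> where "\<rho> = transpose a b \<circ> \<tau>"
    have "\<rho> permutes A" unfolding \<rho>_def
      using ab \<tau>(1) by (intro permutes_compose permutes_swap_id) (auto simp: B_def intro: permutes_subset)
    moreover have "\<rho> \<circ> \<rho> = id"
      by (auto simp: \<rho>_def fun_eq_iff transpose_def \<tau>ab \<tau>\<tau> fix1)
    moreover have "{x \<in> A. \<rho> x = x} = {x \<in> B. \<tau> x = x}"
      using ab by (auto simp: \<rho>_def B_def transpose_def fix1 \<tau>ab)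
    ultimately show ?thesis using \<tau>(3) by metis
  qed
qed

lemma act_vert_nth:
  assumes "\<pi> permutes {..<n}" "length v = n" "i < n"
  shows "act_vert \<pi> v ! \<pi> i = v ! i"
proof -
  have "\<pi> i < n" using permutes_in_image[OF assms(1), of i] assms(3) by simp
  then show ?thesis
    using assms permutes_inverses(2)[OF assms(1)] permutes_inv[OF assms(1)]
    by (simp add: act_vert_def permute_list_nth)
qed

lemma act_vert_eqI:
  assumes "\<pi> permutes {..<n}" "length v = n" "\<And>i. i < n \<Longrightarrow> v ! \<pi> i = v ! i"
  shows "act_vert \<pi> v = v"
proof (rule nth_equalityI)
  show "length (act_vert \<pi> v) = length v" by (simp add: act_vert_def)
  fix j assume "j < length (act_vert \<pi> v)"
  then have "j \<in> \<pi> ` {..<n}" using assms(2) permutes_image[OF assms(1)] by (simp add: act_vert_def)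
  then obtain i where "j = \<pi> i" "i < n" by auto
  then show "act_vert \<pi> v ! j = v ! j"
    using act_vert_nth[OF assms(1,2)] assms(3) by simp
qed

context symmetric_circuit
begin

text \<open>Of four ones of \<open>u\<close>, one may be lost at the position where \<open>u\<close>
  and \<open>v\<close> differ and one as a fixed point of the involution, so two are moved; likewise
  for the zeros. In all, at most three positions are fixed, so \<open>4 * q + 6\<close> positions
  leave \<open>4 * q + 3\<close> moved ones.\<close>

lemma sensitive_unbalanced:
  assumes g: "g \<in> input_gates C" and sens: "sensitive_to C g" and uv: "elabel C g = {u, v}"
    and orb: "\<And>h h'. h \<in> gates C \<Longrightarrow> h' \<in> children C h \<Longrightarrow> card (stab_orbit n C h h') \<le> m"
    and q: "m < q * q" "4 * q + 6 \<le> n"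
  shows "num_ones u < 4 \<or> num_zeros u < 4"
proof (rule ccontr)
  assume "\<not> ?thesis"
  then have many: "4 \<le> num_ones u" "4 \<le> num_zeros u" by auto
  have "{u, v} \<in> cube_edges n" using label_edge[OF g] uv by simp
  then obtain u' v' where uv': "{u, v} = {u', v'}" "length u' = n" "length v' = n"
    "card {i. i < n \<and> u' ! i \<noteq> v' ! i} = 1"
    by (auto simp: cube_edges_def cube_verts_def)
  have len: "length u = n" "length v = n" using uv'(1-3) by (auto simp: doubleton_eq_iff)
  have "{i. i < n \<and> u ! i \<noteq> v ! i} = {i. i < n \<and> u' ! i \<noteq> v' ! i}"
    using uv'(1) by (auto simp: doubleton_eq_iff)
  then have "card {i. i < n \<and> u ! i \<noteq> v ! i} = 1" using uv'(4) by simp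
  then obtain c where c: "{i. i < n \<and> u ! i \<noteq> v ! i} = {c}" by (auto simp: card_1_singleton_iff)
  define A B where "A = {i. i < n \<and> u ! i} - {c}" and "B = {i. i < n \<and> \<not> u ! i} - {c}"
  have fin: "finite A" "finite B" by (auto simp: A_def B_def)
  have card: "3 \<le> card A" "3 \<le> card B"
    using many len diff_card_le_card_Diff[of "{c}" "{i. i < n \<and> u ! i}"]
      diff_card_le_card_Diff[of "{c}" "{i. i < n \<and> \<not> u ! i}"]
    by (auto simp: num_ones_def num_zeros_def A_def B_def)
  have disj: "A \<inter> B = {}" "A \<subseteq> {..<n}" "B \<subseteq> {..<n}" "{..<n} \<subseteq> A \<union> B \<union> {c}"
    by (auto simp: A_def B_def)
  have valA: "u ! i \<and> v ! i" if "i \<in> A" for i using that c by (auto simp: A_def)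
  have valB: "\<not> u ! i \<and> \<not> v ! i" if "i \<in> B" for i using that c by (auto simp: B_def)
  obtain \<alpha> where \<alpha>: "\<alpha> permutes A" "\<alpha> \<circ> \<alpha> = id" "card {x \<in> A. \<alpha> x = x} \<le> 1"
    using ex_involution[OF fin(1)] by blast
  obtain \<beta> where \<beta>: "\<beta> permutes B" "\<beta> \<circ> \<beta> = id" "card {x \<in> B. \<beta> x = x} \<le> 1"
    using ex_involution[OF fin(2)] by blast
  \<comment> \<open>\<tau> exchanges only positions that carry the same bit in \<open>u\<close> and
    the same bit in \<open>v\<close>, so it fixes both words and not merely the edge.\<close>
  define \<tau> where "\<tau> = \<alpha> \<circ> \<beta>"
  have \<tau>A: "\<tau> i = \<alpha> i" "\<alpha> i \<in> A" if "i \<in> A" for i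
  proof -
    have "i \<notin> B" using that disj(1) by blast
    then show "\<tau> i = \<alpha> i" using permutes_not_in[OF \<beta>(1), of i] by (simp add: \<tau>_def)
    show "\<alpha> i \<in> A" using that permutes_in_image[OF \<alpha>(1), of i] by simp
  qed
  have \<tau>B: "\<tau> i = \<beta> i" "\<beta> i \<in> B" if "i \<in> B" for i
  proof -
    show \<beta>i: "\<beta> i \<in> B" using that permutes_in_image[OF \<beta>(1), of i] by simp
    then have "\<beta> i \<notin> A" using disj(1) by blast
    then show "\<tau> i = \<beta> i" using permutes_not_in[OF \<alpha>(1), of "\<beta> i"] by (simp add: \<tau>_def)
  qed
  have \<tau>O: "\<tau> i = i" if "i \<notin> A \<union> B" for i
    using that permutes_not_in[OF \<beta>(1), of i] permutes_not_in[OF \<alpha>(1), of i] by (auto simp: \<tau>_def)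
  have \<tau>p: "\<tau> permutes {..<n}" unfolding \<tau>_def
    using \<alpha>(1) \<beta>(1) disj by (meson permutes_compose permutes_subset)
  have \<tau>\<tau>: "\<tau> \<circ> \<tau> = id"
  proof
    fix i
    have "\<alpha> (\<alpha> i) = i" "\<beta> (\<beta> i) = i" using \<alpha>(2) \<beta>(2) by (metis comp_apply id_apply)+
    then show "(\<tau> \<circ> \<tau>) i = id i"
      using \<tau>A[of i] \<tau>A[of "\<alpha> i"] \<tau>B[of i] \<tau>B[of "\<beta> i"] \<tau>O[of i] by (cases "i \<in> A"; cases "i \<in> B") auto
  qed
  have val: "u ! \<tau> i = u ! i" "v ! \<tau> i = v ! i" for i
    using \<tau>A[of i] \<tau>B[of i] \<tau>O[of i] valA[of i] valA[of "\<alpha> i"] valB[of i] valB[of "\<beta> i"]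
    by (cases "i \<in> A"; cases "i \<in> B"; simp)+
  have "act_vert \<tau> u = u" "act_vert \<tau> v = v"
    using act_vert_eqI[OF \<tau>p] len val by auto
  then have edge: "act_edge \<tau> (elabel C g) = elabel C g" by (simp add: act_edge_def uv)
  define \<Omega> where "\<Omega> = {i. i < n \<and> \<tau> i \<noteq> i}"
  define FA FB where "FA = {x \<in> A. \<alpha> x = x}" and "FB = {x \<in> B. \<beta> x = x}"
  have \<Omega>A: "A - FA \<subseteq> \<Omega>" and \<Omega>B: "B - FB \<subseteq> \<Omega>"
    using \<tau>A(1) \<tau>B(1) disj by (auto simp: \<Omega>_def FA_def FB_def)
  have finF: "finite FA" "finite FB" using fin by (auto simp: FA_def FB_def)
  have F1: "card FA \<le> 1" "card FB \<le> 1" using \<alpha>(3) \<beta>(3) by (auto simp: FA_def FB_def)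
  have "{..<n} - (FA \<union> FB \<union> {c}) \<subseteq> \<Omega>"
    using \<Omega>A \<Omega>B disj(4) by auto
  then have "card ({..<n} - (FA \<union> FB \<union> {c})) \<le> card \<Omega>"
    by (rule card_mono[rotated]) (simp add: \<Omega>_def)
  moreover have "card (FA \<union> FB \<union> {c}) \<le> 3"
    using F1 card_Un_le[of FA FB] card_Un_le[of "FA \<union> FB" "{c}"] by simp
  moreover have "n - card (FA \<union> FB \<union> {c}) \<le> card ({..<n} - (FA \<union> FB \<union> {c}))"
    using diff_card_le_card_Diff[of "FA \<union> FB \<union> {c}" "{..<n}"] finF by simp
  ultimately have "4 * q + 3 \<le> card \<Omega>" using q(2) by linarith
  then have alt: "contains_alt (gate_stab g) \<Omega>"
    using sensitive_contains_alt[OF g sens orb \<tau>p \<tau>\<tau> edge q(1)] by (simp add: \<Omega>_def)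
  have "2 \<le> card (A - FA)" "2 \<le> card (B - FB)"
    using card F1 finF diff_card_le_card_Diff[of FA A] diff_card_le_card_Diff[of FB B] by auto
  then have "A - FA \<noteq> {}" "\<exists>b d. {b, d} \<subseteq> B - FB \<and> b \<noteq> d"
    by (fastforce simp: numeral_2_eq_2 card_le_Suc_iff)+
  then obtain a b d where abd: "a \<in> A - FA" "b \<in> B - FB" "d \<in> B - FB" "b \<noteq> d"
    by blast
  then have ne: "a \<noteq> b" "a \<noteq> d" using disj by auto
  \<comment> \<open>This cycle carries the one at \<open>a\<close> to position \<open>b\<close>,
    where \<open>u\<close> and \<open>v\<close> both have a zero, so the image of \<open>u\<close>
    is neither of them.\<close>
  define \<pi> where "\<pi> = cyc3 a b d"
  have "a \<in> \<Omega>" "b \<in> \<Omega>" "d \<in> \<Omega>" using abd \<Omega>A \<Omega>B by auto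
  then have \<pi>: "\<pi> \<in> gate_stab g"
    using contains_altD[OF alt] abd(4) ne by (simp add: \<pi>_def)
  then have "\<pi> permutes {..<n}" by (simp add: gate_stab_def)
  then have "act_vert \<pi> u ! \<pi> a = u ! a"
    using act_vert_nth len(1) abd disj(2) by blast
  then have "act_vert \<pi> u ! b" using valA abd by (simp add: \<pi>_def)
  moreover have "act_vert \<pi> u \<in> {u, v}"
    using gate_stab_input[OF g \<pi>] by (auto simp: uv act_edge_def)
  ultimately show False using valB[of b] abd by auto
qed

end

section \<open>The asymptotic statement\<close>

theorem theorem8p1:
  fixes C :: "nat \<Rightarrow> 'g circuit"
  assumes circ: "\<forall>n\<ge>1. xor_circuit n (C n)"
    and size: "\<exists>p :: real poly. \<forall>n\<ge>1. real (card (gates (C n))) \<le> poly p (2 ^ n)"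
    and sym: "\<forall>n\<ge>1. \<forall>\<pi>. \<pi> permutes {..<n} \<longrightarrow> (\<exists>\<sigma>. extends_to (C n) \<pi> \<sigma>)"
    and orbits: "\<exists>f :: nat \<Rightarrow> real. f \<in> O(\<lambda>n. real n) \<and>
      (\<forall>\<^sub>F n in sequentially. \<forall>g\<in>gates (C n). \<forall>h\<in>parents (C n) g.
         real (card (stab_orbit n (C n) g h)) \<le> f n \<and>
         real (card (stab_orbit n (C n) h g)) \<le> f n)"
  shows "\<forall>\<epsilon>::real. \<epsilon> > 0 \<longrightarrow>
    (\<forall>\<^sub>F n in sequentially. \<forall>g\<in>input_gates (C n). \<forall>u v.
       sensitive_to (C n) g \<and> elabel (C n) g = {u, v} \<longrightarrow>
       (\<exists>w\<in>{u, v}. real (num_ones w) < \<epsilon> * real n \<or> real (num_zeros w) < \<epsilon> * real n))"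
proof (intro allI impI)
  fix \<epsilon> :: real assume \<epsilon>: "\<epsilon> > 0"
  obtain f where f: "f \<in> O(\<lambda>n. real n)" and orb: "\<forall>\<^sub>F n in sequentially. \<forall>g\<in>gates (C n). \<forall>h\<in>parents (C n) g.
         real (card (stab_orbit n (C n) g h)) \<le> f n \<and> real (card (stab_orbit n (C n) h g)) \<le> f n"
    using orbits by blast
  obtain K where K: "K > 0" "\<forall>\<^sub>F n in sequentially. norm (f n) \<le> K * norm (real n)"
    using f by (elim landau_o.bigE)
  \<comment> \<open>The parameter \<open>q\<close> will be about a quarter of \<open>n\<close>, so
    its square outgrows the linear orbit bound. The shift by 10 absorbs the rounding in
    \<open>q\<close>.\<close>
  have "\<forall>\<^sub>F n in sequentially. K * real n < ((real n - 10) / 4)\<^sup>2" by real_asymp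
  \<comment> \<open>This turns the constant bound 4 of \<open>sensitive_unbalanced\<close> into a
    bound by \<epsilon> times \<open>n\<close>.\<close>
  moreover have "\<forall>\<^sub>F n in sequentially. \<epsilon> * real n \<ge> 4" using \<epsilon> by real_asymp
  ultimately show "\<forall>\<^sub>F n in sequentially. \<forall>g\<in>input_gates (C n). \<forall>u v.
       sensitive_to (C n) g \<and> elabel (C n) g = {u, v} \<longrightarrow>
       (\<exists>w\<in>{u, v}. real (num_ones w) < \<epsilon> * real n \<or> real (num_zeros w) < \<epsilon> * real n)"
    using orb K(2) eventually_ge_at_top[of 10]
  proof eventually_elim
    case (elim n)
    interpret symmetric_circuit n "C n"
      using circ sym elim(5) by unfold_locales auto
    \<comment> \<open>The largest \<open>q\<close> that \<open>sensitive_unbalanced\<close> admits.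
      As \<open>n\<close> is at least 10, the subtraction does not truncate, and
      \<open>real n - 10\<close> is nonnegative, so squaring below is monotone.\<close>
    define q where "q = (n - 6) div 4"
    define m where "m = nat \<lfloor>K * real n\<rfloor>"
    have q: "4 * q + 6 \<le> n" "n \<le> 4 * q + 9" using elim(5) by (auto simp: q_def)
    have "real n - 10 \<ge> 0" using elim(5) by simp
    moreover have "(real n - 10) / 4 \<le> real q" using q(2) by (simp add: field_simps)
    ultimately have "((real n - 10) / 4)\<^sup>2 \<le> (real q)\<^sup>2" by (intro power_mono) auto
    then have "K * real n < real (q * q)" using elim(1) by (simp add: power2_eq_square)
    then have mq: "m < q * q" using K(1) by (simp add: m_def nat_less_iff floor_less_iff)
    have orb': "card (stab_orbit n (C n) h h') \<le> m" if "h \<in> gates (C n)" "h' \<in> children (C n) h" for h h'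
    proof -
      have "h' \<in> gates (C n)" "h \<in> parents (C n) h'"
        using that children_gates by (auto simp: children_def parents_def)
      then have "real (card (stab_orbit n (C n) h h')) \<le> f n" using elim(3) by blast
      also have "\<dots> \<le> K * real n" using elim(4) by simp
      finally show ?thesis by (simp add: m_def le_nat_floor)
    qed
    show ?case
    proof (intro ballI allI impI)
      fix g u v
      assume "g \<in> input_gates (C n)" "sensitive_to (C n) g \<and> elabel (C n) g = {u, v}"
      then have "num_ones u < 4 \<or> num_zeros u < 4"
        using sensitive_unbalanced[OF _ _ _ orb' mq q(1), of g u v] by simp
      then have "real (num_ones u) < \<epsilon> * real n \<or> real (num_zeros u) < \<epsilon> * real n"
        using elim(2) by linarith
      then show "\<exists>w\<in>{u, v}. real (num_ones w) < \<epsilon> * real n \<or> real (num_zeros w) < \<epsilon> * real n"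
        by blast
    qed
  qed
qed

end
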